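(* Let $M\ge 1$, let $0<x_1<x_2<\cdots<x_M$ be real numbers and let $a_1,\dots,a_M$ be real numbers, not all zero. Let $$X(x,y)=\sum_{j=1}^M\frac{a_j(x-x_j)}{((x-x_j)^2+y^2)^{3/2}},\qquad Y(x,y)=\sum_{j=1}^M\frac{a_jy}{((x-x_j)^2+y^2)^{3/2}}$$ for $(x,y)\in\mathbb{R}^2\setminus\{(x_1,0),\dots,(x_M,0)\}$. Then every bounded disk of $\mathbb{R}^2$ contains only finitely many points $(x,y)$ with $X(x,y)=Y(x,y)=0$.
   Context: The vector field $\mathbf{F}=(X,Y)$ is the planar electric field of charges $a_j$ placed at the points $(x_j,0)$ on the positive $x$-axis; its zero set is the set of points (away from the charges) where $X=Y=0$. *)

theory Defs
  imports "HOL-Analysis.Analysis"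
begin

definition charge_points :: "nat \<Rightarrow> (nat \<Rightarrow> real) \<Rightarrow> (real \<times> real) set" where
  "charge_points M xs = {(xs j, 0) | j. j \<in> {1..M}}"

text \<open>
  The two components of the planar field of charges \<open>a j\<close> at the points \<open>(xs j, 0)\<close>. They are meant
  for points outside \<^const>\<open>charge_points\<close>, where the base of every power is positive; at a
  charge point they take junk values, since \<open>0 powr (3/2) = 0\<close> and division by zero is zero.
\<close>

definition field_X :: "nat \<Rightarrow> (nat \<Rightarrow> real) \<Rightarrow> (nat \<Rightarrow> real) \<Rightarrow> real \<Rightarrow> real \<Rightarrow> real" where
  "field_X M xs a x y = (\<Sum>j=1..M. a j * (x - xs j) / ((x - xs j)\<^sup>2 + y\<^sup>2) powr (3/2))"

definition field_Y :: "nat \<Rightarrow> (nat \<Rightarrow> real) \<Rightarrow> (nat \<Rightarrow> real) \<Rightarrow> real \<Rightarrow> real \<Rightarrow> real" where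
  "field_Y M xs a x y = (\<Sum>j=1..M. a j * y / ((x - xs j)\<^sup>2 + y\<^sup>2) powr (3/2))"

text \<open>All the charge points are removed, including those with \<open>a j = 0\<close>.\<close>

definition field_zeros :: "nat \<Rightarrow> (nat \<Rightarrow> real) \<Rightarrow> (nat \<Rightarrow> real) \<Rightarrow> (real \<times> real) set" where
  "field_zeros M xs a =
     {(x, y). (x, y) \<notin> charge_points M xs \<and> field_X M xs a x y = 0 \<and> field_Y M xs a x y = 0}"

end

theory Submission
  imports Defs
begin

text \<open>
  Identify the plane with the complex numbers, \<open>z = x + i y\<close>, and drop the points whose charge is
  zero. Up to sign and conjugation the field is the single complex function
  \<open>E(z) = \<Sum>\<^sub>j a\<^sub>j / ((x\<^sub>j - z) |x\<^sub>j - z|)\<close>. By compactness it suffices that the zeros of \<open>E\<close> do not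
  accumulate at any point \<open>p\<close>. At a charge this is clear, because one summand blows up while the
  others stay bounded.

  At any other \<open>p\<close> put \<open>u\<^sub>j = 1 / (x\<^sub>j - p)\<close>. The binomial series for the exponents \<open>-3/2\<close> and \<open>-1/2\<close>
  turn \<open>1 / ((1 - w) |1 - w|) = (1 - w) powr (-3/2) * (1 - cnj w) powr (-1/2)\<close> into a series in \<open>w\<close>
  and \<open>cnj w\<close>, so \<open>E(p + h)\<close> is a series of forms \<open>F\<^sub>k(h)\<close>, homogeneous of degree \<open>k\<close> in \<open>h\<close> and
  \<open>cnj h\<close>, whose coefficients are binomial coefficients times the moments
  \<open>T(m, n) = \<Sum>\<^sub>j a\<^sub>j |u\<^sub>j| u\<^sub>j^m (cnj u\<^sub>j)^n\<close>. If the first nonzero form \<open>F\<^sub>d\<close> vanishes only at \<open>h = 0\<close>,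
  then \<open>|F\<^sub>d(h)|\<close> is at least a constant times \<open>|h|^d\<close> and dominates the remainder, which is
  \<open>O(|h|^(d+1))\<close> (\<open>charge_field_nonzero_near_of_leading_form\<close>). Some moment \<open>T(d+1, 0)\<close> is nonzero,
  since the \<open>u\<^sub>j\<close> are distinct (\<open>exists_nonzero_moment\<close>); take the least such \<open>d\<close>. It remains to see
  that \<open>F\<^sub>d\<close> has this property. There are two cases.

  Off the axis the identity \<open>(cnj p - p) u\<^sub>j (cnj u\<^sub>j) = cnj u\<^sub>j - u\<^sub>j\<close> relates moments of different
  total degree (\<open>moment_relation\<close>). It forces the lower forms and all mixed coefficients of \<open>F\<^sub>d\<close> to
  vanish, so \<open>F\<^sub>d(h)\<close> is a nonzero multiple of \<open>h^d\<close>. This is the algebraic trace of the fact that the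
  field locally satisfies an inequality \<open>|\<partial>E/\<partial>(cnj z)| \<le> C |E|\<close>, so that its leading term is
  holomorphic.

  On the axis the moments depend on \<open>m + n\<close> only, and \<open>F\<^sub>d\<close> is a nonzero multiple of one universal
  form, the gradient of a zonal solid harmonic. After division by \<open>(cnj h)^d\<close> it is a polynomial in
  \<open>h / cnj h\<close> with positive, strictly increasing coefficients; such a polynomial has no zero on the
  unit circle by the argument of Enestroem and Kakeya
  (\<open>polynomial_increasing_coeffs_nonzero_on_circle\<close>, \<open>point_form_nonzero\<close>).
\<close>

section \<open>Polynomials with increasing coefficients\<close>

text \<open>
  Let \<open>n > 0\<close>. At a zero, multiplying the polynomial by \<open>1 - v\<close> exhibits \<open>q n * v ^ (n + 1)\<close> as a combination of
  powers of \<open>v\<close> whose positive coefficients \<open>q 0\<close>, \<open>q 1 - q 0\<close>, \<dots> add up to \<open>q n\<close>. This is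
  equality in the triangle inequality, so the first two terms \<open>q 0\<close> and \<open>(q 1 - q 0) * v\<close> point in the
  same direction. Hence \<open>v = 1\<close>, where the value is a sum of positive numbers.
\<close>

lemma polynomial_increasing_coeffs_nonzero_on_circle:
  fixes q :: "nat \<Rightarrow> real" and v :: complex
  assumes pos: "0 < q 0" and incr: "\<And>i. i < n \<Longrightarrow> q i < q (Suc i)" and v: "norm v = 1"
  shows "(\<Sum>i\<le>n. of_real (q i) * v ^ i) \<noteq> 0"
proof
  assume zero: "(\<Sum>i\<le>n. of_real (q i) * v ^ i) = 0"
  have q_pos: "0 < q i" if "i \<le> n" for i
    using that by (induction i) (use pos incr in \<open>auto intro: less_trans simp: Suc_le_eq\<close>)
  have "n \<noteq> 0"
    using zero pos by (intro notI) simp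
  then obtain m where n: "n = Suc m"
    using not0_implies_Suc by blast
  have "(1 - v) * (\<Sum>i\<le>k. of_real (q i) * v ^ i) =
      of_real (q 0) + (\<Sum>i<k. of_real (q (Suc i) - q i) * v ^ Suc i) - of_real (q k) * v ^ Suc k" for k
    by (induction k) (simp_all add: algebra_simps)
  from this[of n] have "of_real (q n) * v ^ Suc n =
      of_real (q 0) + (\<Sum>i<Suc m. of_real (q (Suc i) - q i) * v ^ Suc i)"
    using zero n by simp
  also have "\<dots> = (of_real (q 0) + of_real (q 1 - q 0) * v)
      + (\<Sum>i<m. of_real (q (Suc (Suc i)) - q (Suc i)) * v ^ Suc (Suc i))"
    by (subst sum.lessThan_Suc_shift) simp
  finally have telescoped: "of_real (q n) * v ^ Suc n = \<dots>" .
  \<comment> \<open>Only the first two terms are kept together; the others are bounded one by one.\<close>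
  have "q n = norm (of_real (q n) * v ^ Suc n)"
    using v q_pos[of n] by (simp add: norm_mult norm_power del: power_Suc)
  also have "\<dots> \<le> norm (of_real (q 0) + of_real (q 1 - q 0) * v)
      + (\<Sum>i<m. norm (of_real (q (Suc (Suc i)) - q (Suc i)) * v ^ Suc (Suc i)))"
    unfolding telescoped by (intro norm_triangle_mono order_refl norm_sum)
  also have "(\<Sum>i<m. norm (of_real (q (Suc (Suc i)) - q (Suc i)) * v ^ Suc (Suc i)))
      = (\<Sum>i<m. q (Suc (Suc i)) - q (Suc i))"
  proof (rule sum.cong)
    fix i assume "i \<in> {..<m}"
    then have "q (Suc i) < q (Suc (Suc i))"
      using incr n by simp
    moreover have "norm (v ^ Suc (Suc i)) = 1"
      using v by (simp only: norm_power power_one)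
    ultimately show "norm (of_real (q (Suc (Suc i)) - q (Suc i)) * v ^ Suc (Suc i))
        = q (Suc (Suc i)) - q (Suc i)"
      by (simp only: norm_mult norm_of_real) simp
  qed simp
  also have "\<dots> = q n - q 1"
    using sum_lessThan_telescope[of "\<lambda>i. q (Suc i)" m] n by simp
  finally have "q 1 \<le> norm (of_real (q 0) + of_real (q 1 - q 0) * v)"
    by simp
  then have "(q 1)\<^sup>2 \<le> (norm (of_real (q 0) + of_real (q 1 - q 0) * v))\<^sup>2"
    using q_pos[of 1] n by (intro power_mono) auto
  also have "\<dots> = (q 0 + (q 1 - q 0) * Re v)\<^sup>2 + ((q 1 - q 0) * Im v)\<^sup>2"
    by (simp add: cmod_power2)
  finally have "(q 1)\<^sup>2 \<le> (q 0 + (q 1 - q 0) * Re v)\<^sup>2 + ((q 1 - q 0) * Im v)\<^sup>2" .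
  moreover have v2: "(Re v)\<^sup>2 + (Im v)\<^sup>2 = 1"
    using v by (metis cmod_power2 power_one)
  ultimately have "(q 1)\<^sup>2 \<le> (q 0)\<^sup>2 + 2 * q 0 * (q 1 - q 0) * Re v + (q 1 - q 0)\<^sup>2"
  proof -
    assume a: "(q 1)\<^sup>2 \<le> (q 0 + (q 1 - q 0) * Re v)\<^sup>2 + ((q 1 - q 0) * Im v)\<^sup>2"
    have "(q 0 + (q 1 - q 0) * Re v)\<^sup>2 + ((q 1 - q 0) * Im v)\<^sup>2
       = (q 0)\<^sup>2 + 2 * q 0 * (q 1 - q 0) * Re v + (q 1 - q 0)\<^sup>2 * ((Re v)\<^sup>2 + (Im v)\<^sup>2)"
      by algebra
    with a v2 show ?thesis by simp
  qed
  then have "2 * (q 0 * (q 1 - q 0)) * 1 \<le> 2 * (q 0 * (q 1 - q 0)) * Re v"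
    by (simp add: power2_eq_square algebra_simps)
  then have "1 \<le> Re v"
    using pos incr[of 0] n by (subst (asm) mult_le_cancel_left_pos) auto
  then have "(Re v)\<^sup>2 \<ge> 1" by simp
  with v2 have "(Im v)\<^sup>2 \<le> 0" by linarith
  then have "Im v = 0" by simp
  with v2 \<open>1 \<le> Re v\<close> have "v = 1"
    by (auto simp: complex_eq_iff power2_eq_1_iff)
  then have "of_real (\<Sum>i\<le>n. q i) = (0 :: complex)"
    using zero by simp
  then have "(\<Sum>i\<le>n. q i) = 0"
    by (simp only: of_real_eq_0_iff)
  moreover have "(\<Sum>i\<le>n. q i) > 0"
    using q_pos by (intro sum_pos) auto
  ultimately show False by simp
qed

section \<open>The field of a single charge\<close>

text \<open>
  The coefficients of \<open>(1 - w) powr (-s)\<close>; expanding in \<open>1 - w\<close> instead of \<open>1 + w\<close> makes them positive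
  for \<open>s > 0\<close>.
\<close>

definition binom_coeff :: "real \<Rightarrow> nat \<Rightarrow> real" where
  "binom_coeff s n = pochhammer s n / fact n"

lemma binom_coeff_0 [simp]: "binom_coeff s 0 = 1"
  by (simp add: binom_coeff_def)

lemma binom_coeff_pos: "0 < s \<Longrightarrow> 0 < binom_coeff s n"
  by (simp add: binom_coeff_def pochhammer_pos)

lemma binom_coeff_Suc: "binom_coeff s (Suc n) = binom_coeff s n * ((s + n) / (n + 1))"
  by (simp add: binom_coeff_def pochhammer_Suc field_simps)

lemma binom_coeff_strict_increasing: "1 < s \<Longrightarrow> binom_coeff s n < binom_coeff s (Suc n)"
  using binom_coeff_pos[of s n] by (simp add: binom_coeff_Suc field_simps)

lemma binom_coeff_strict_decreasing: "0 < s \<Longrightarrow> s < 1 \<Longrightarrow> binom_coeff s (Suc n) < binom_coeff s n"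
  using binom_coeff_pos[of s n] by (simp add: binom_coeff_Suc field_simps)

lemma binomial_series_sums:
  fixes w :: complex
  assumes "norm w < 1"
  shows "(\<lambda>n. of_real (binom_coeff s n) * w ^ n) sums ((1 - w) powr (- of_real s))"
proof -
  have "((- of_real s) gchoose n) * (- w) ^ n = of_real (binom_coeff s n) * w ^ n" for n
  proof -
    have "of_real (pochhammer s n) = (pochhammer (of_real s) n :: complex)"
      by (simp add: pochhammer_of_real)
    moreover have "(- 1) ^ n * (- w) ^ n = w ^ n"
      by (simp flip: power_mult_distrib)
    ultimately show ?thesis
      by (simp add: gbinomial_pochhammer binom_coeff_def)
  qed
  with gen_binomial_complex[of "- w" "- of_real s"] assms show ?thesis
    by simp
qed

lemma summable_norm_binomial_series:
  fixes w :: complex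
  assumes "norm w < 1"
  shows "summable (\<lambda>n. norm (of_real (binom_coeff s n) * w ^ n))"
proof -
  obtain r where r: "norm w < r" "r < 1"
    using assms dense by blast
  then have "0 < r"
    using norm_ge_zero[of w] by linarith
  have "summable (\<lambda>n. of_real (binom_coeff s n) * (of_real r :: complex) ^ n)"
    using binomial_series_sums[of "of_real r" s] \<open>0 < r\<close> r(2) by (auto simp: sums_iff)
  then show ?thesis
    by (rule powser_insidea) (use r \<open>0 < r\<close> in auto)
qed

text \<open>
  The inverse square law in the complex plane: \<open>1 / (w |w|) = cnj w / |w|^3\<close>. This function is
  multiplicative in \<open>w\<close>, which allows the position of a charge to be factored out.
\<close>

definition point_field :: "complex \<Rightarrow> complex" where
  "point_field w = 1 / (w * of_real (norm w))"

lemma point_field_mult: "point_field (z * w) = point_field z * point_field w"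
  by (simp add: point_field_def norm_mult)

text \<open>
  The part of degree \<open>k\<close> of the expansion of \<open>point_field (1 - w)\<close> in \<open>w\<close> and \<open>cnj w\<close>.
\<close>

definition point_form :: "nat \<Rightarrow> complex \<Rightarrow> complex" where
  "point_form k w = (\<Sum>i\<le>k. of_real (binom_coeff (3/2) i) * w ^ i *
       (of_real (binom_coeff (1/2) (k - i)) * cnj w ^ (k - i)))"

text \<open>
  With \<open>B = (1 - w) powr (-1/2)\<close> the right-hand side is \<open>B^3 * cnj B = B^2 * |B|^2\<close>. The principal
  branch commutes with conjugation because \<open>1 - w\<close> lies in the right half-plane.
\<close>

lemma point_field_eq_powr:
  assumes "norm w < 1"
  shows "point_field (1 - w) = (1 - w) powr (- of_real (3/2)) * (1 - cnj w) powr (- of_real (1/2))"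
proof -
  define B where "B = (1 - w) powr (- of_real (1/2))"
  have nz: "1 - w \<noteq> 0" using assms by auto
  have "\<bar>Re w\<bar> < 1" using assms abs_Re_le_cmod[of w] by linarith
  then have cnj_B: "cnj B = (1 - cnj w) powr (- of_real (1/2))"
    unfolding B_def by (subst cnj_powr) auto
  have B2: "B * B = inverse (1 - w)"
    unfolding B_def powr_add[symmetric] using nz by (simp add: powr_minus)
  have A: "(1 - w) powr (- of_real (3/2)) = inverse (1 - w) * B"
    unfolding B2[symmetric] unfolding B_def powr_add[symmetric] by simp
  have "B * cnj B = of_real ((norm B)\<^sup>2)"
    by (simp only: complex_norm_square)
  also have "\<dots> = of_real (norm (B * B))"
    by (simp only: norm_mult power2_eq_square)
  also have "\<dots> = inverse (of_real (norm (1 - w)))"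
    unfolding B2 by (simp add: norm_inverse)
  finally have "B * cnj B = inverse (of_real (norm (1 - w)))" .
  then have "point_field (1 - w) = inverse (1 - w) * (B * cnj B)"
    by (simp only: point_field_def divide_inverse inverse_mult_distrib mult_1_left)
  then show ?thesis
    by (simp only: A cnj_B mult.assoc)
qed

lemma point_form_sums:
  assumes "norm w < 1"
  shows "(\<lambda>k. point_form k w) sums point_field (1 - w)"
proof -
  have "norm (cnj w) < 1" using assms by simp
  note w = binomial_series_sums[OF assms, of "3/2"] binomial_series_sums[OF this, of "1/2"]
    and s = summable_norm_binomial_series[OF assms, of "3/2"]
      summable_norm_binomial_series[OF this, of "1/2"]
  show ?thesis
    using Cauchy_product_sums[OF s] unfolding point_form_def point_field_eq_powr[OF assms]
      sums_unique[OF w(1)] sums_unique[OF w(2)] .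
qed

lemma point_form_homogeneous:
  "point_form k (of_real t * w) = of_real t ^ k * point_form k w"
  unfolding point_form_def sum_distrib_left
proof (rule sum.cong)
  fix i assume "i \<in> {..k}"
  then have "(of_real t :: complex) ^ k = of_real t ^ i * of_real t ^ (k - i)"
    by (simp flip: power_add)
  then show "of_real (binom_coeff (3/2) i) * (of_real t * w) ^ i *
      (of_real (binom_coeff (1/2) (k - i)) * cnj (of_real t * w) ^ (k - i)) =
    of_real t ^ k * (of_real (binom_coeff (3/2) i) * w ^ i *
      (of_real (binom_coeff (1/2) (k - i)) * cnj w ^ (k - i)))"
    by (simp add: power_mult_distrib)
qed simp

text \<open>
  The coefficients of \<open>point_form k\<close> are positive, so their sum is at once its value and its norm at
  \<open>1\<close>. This makes the values at \<open>1\<close> a majorant for the forms.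
\<close>

lemma norm_point_form_one:
  "norm (point_form k 1) = (\<Sum>i\<le>k. binom_coeff (3/2) i * binom_coeff (1/2) (k - i))"
  and point_form_one: "point_form k 1 = of_real (norm (point_form k 1))"
proof -
  have "point_form k 1 = of_real (\<Sum>i\<le>k. binom_coeff (3/2) i * binom_coeff (1/2) (k - i))"
    by (simp add: point_form_def)
  moreover have "0 \<le> (\<Sum>i\<le>k. binom_coeff (3/2) i * binom_coeff (1/2) (k - i))"
    by (intro sum_nonneg mult_nonneg_nonneg less_imp_le binom_coeff_pos) auto
  ultimately show "norm (point_form k 1) =
      (\<Sum>i\<le>k. binom_coeff (3/2) i * binom_coeff (1/2) (k - i))"
    and "point_form k 1 = of_real (norm (point_form k 1))"
    by (simp_all only: norm_of_real abs_of_nonneg)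
qed

lemma norm_point_form_le: "norm (point_form k w) \<le> norm (point_form k 1) * norm w ^ k"
proof -
  have "norm (point_form k w) \<le> (\<Sum>i\<le>k. norm (of_real (binom_coeff (3/2) i) * w ^ i *
       (of_real (binom_coeff (1/2) (k - i)) * cnj w ^ (k - i))))"
    unfolding point_form_def by (rule norm_sum)
  also have "\<dots> = norm (point_form k 1) * norm w ^ k"
    unfolding norm_point_form_one sum_distrib_right
  proof (rule sum.cong)
    fix i assume "i \<in> {..k}"
    then have "norm w ^ k = norm w ^ i * norm w ^ (k - i)"
      by (simp flip: power_add)
    then show "norm (of_real (binom_coeff (3/2) i) * w ^ i *
       (of_real (binom_coeff (1/2) (k - i)) * cnj w ^ (k - i))) =
       binom_coeff (3/2) i * binom_coeff (1/2) (k - i) * norm w ^ k"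
      using binom_coeff_pos[of "3/2" i] binom_coeff_pos[of "1/2" "k - i"]
      by (simp add: norm_mult norm_power)
  qed simp
  finally show ?thesis .
qed

text \<open>
  The coefficients for \<open>3/2\<close> increase and those for \<open>1/2\<close> decrease, so in the product of index
  \<open>i\<close> and \<open>d - i\<close> both factors increase with \<open>i\<close>.
\<close>

lemma point_form_nonzero:
  assumes "w \<noteq> 0"
  shows "point_form d w \<noteq> 0"
proof -
  define q where "q i = binom_coeff (3/2) i * binom_coeff (1/2) (d - i)" for i
  have nz: "cnj w \<noteq> 0" using assms by simp
  have "point_form d w = cnj w ^ d * (\<Sum>i\<le>d. of_real (q i) * (w / cnj w) ^ i)"
    unfolding point_form_def sum_distrib_left
  proof (rule sum.cong)
    fix i assume "i \<in> {..d}"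
    then have "cnj w ^ d = cnj w ^ i * cnj w ^ (d - i)"
      by (simp flip: power_add)
    then show "of_real (binom_coeff (3/2) i) * w ^ i *
        (of_real (binom_coeff (1/2) (d - i)) * cnj w ^ (d - i)) =
      cnj w ^ d * (of_real (q i) * (w / cnj w) ^ i)"
      using nz by (simp add: q_def power_divide)
  qed simp
  moreover have "(\<Sum>i\<le>d. of_real (q i) * (w / cnj w) ^ i) \<noteq> 0"
  proof (rule polynomial_increasing_coeffs_nonzero_on_circle)
    show "0 < q 0"
      by (simp add: q_def binom_coeff_pos)
    show "norm (w / cnj w) = 1"
      using assms by (simp add: norm_divide)
    fix i assume "i < d"
    then have "d - i = Suc (d - Suc i)" by simp
    then have "binom_coeff (1/2) (d - i) < binom_coeff (1/2) (d - Suc i)"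
      using binom_coeff_strict_decreasing[of "1/2"] by simp
    moreover have "binom_coeff (3/2) i < binom_coeff (3/2) (Suc i)"
      by (rule binom_coeff_strict_increasing) simp
    ultimately show "q i < q (Suc i)"
      unfolding q_def by (intro mult_strict_mono) (auto simp: binom_coeff_pos less_imp_le)
  qed
  ultimately show ?thesis
    using nz by simp
qed

text \<open>
  On the disk of radius \<open>1/2\<close> the tail is \<open>norm w ^ (d + 1)\<close> times a series dominated by the
  positive series at \<open>w = 1/2\<close>.
\<close>

lemma point_field_remainder:
  obtains C where "C \<ge> 0" "\<And>w. norm w \<le> 1/2 \<Longrightarrow>
     norm (point_field (1 - w) - (\<Sum>k\<le>d. point_form k w)) \<le> C * norm w ^ Suc d"
proof -
  define B where "B k = norm (point_form k 1)" for k
  have summ: "summable (\<lambda>k. B k * (1/2) ^ k)"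
  proof -
    have "point_form k (1/2) = of_real (B k * (1/2) ^ k)" for k
    proof -
      have "point_form k (1/2) = of_real ((1/2) ^ k) * point_form k 1"
        using point_form_homogeneous[of k "1/2" 1] by simp
      then show ?thesis
        unfolding B_def by (subst (asm) point_form_one) simp
    qed
    moreover have "summable (\<lambda>k. point_form k (1/2))"
      using point_form_sums[of "1/2"] by (auto simp: sums_iff norm_divide)
    ultimately have "summable (\<lambda>k. of_real (B k * (1/2) ^ k) :: complex)"
      by (simp only:)
    then show ?thesis
      by (simp only: summable_complex_of_real)
  qed
  have summ': "summable (\<lambda>k. B (k + Suc d) * (1/2) ^ k)"
  proof -
    have "summable (\<lambda>k. 2 ^ Suc d * (B (k + Suc d) * (1/2) ^ (k + Suc d)))"
      by (intro summable_mult summable_ignore_initial_segment[OF summ])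
    then show ?thesis
      by (simp add: power_add field_simps)
  qed
  show thesis
  proof
    show "0 \<le> (\<Sum>k. B (k + Suc d) * (1/2) ^ k)"
      by (intro suminf_nonneg summ') (simp add: B_def)
    fix w :: complex assume w: "norm w \<le> 1/2"
    then have tail: "(\<lambda>k. point_form (k + Suc d) w) sums
        (point_field (1 - w) - (\<Sum>k<Suc d. point_form k w))"
      by (intro sums_split_initial_segment point_form_sums) simp
    have bound: "norm (point_form (k + Suc d) w) \<le> norm w ^ Suc d * (B (k + Suc d) * (1/2) ^ k)" for k
    proof -
      have "norm (point_form (k + Suc d) w) \<le> B (k + Suc d) * norm w ^ (k + Suc d)"
        unfolding B_def by (rule norm_point_form_le)
      also have "\<dots> = norm w ^ Suc d * (B (k + Suc d) * norm w ^ k)"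
        by (simp only: power_add mult_ac)
      also have "\<dots> \<le> norm w ^ Suc d * (B (k + Suc d) * (1/2) ^ k)"
        by (intro mult_left_mono power_mono w) (auto simp: B_def)
      finally show ?thesis .
    qed
    have "norm (\<Sum>k. point_form (k + Suc d) w) \<le> (\<Sum>k. norm w ^ Suc d * (B (k + Suc d) * (1/2) ^ k))"
      by (intro norm_suminf_le bound summable_mult summ')
    then show "norm (point_field (1 - w) - (\<Sum>k\<le>d. point_form k w))
        \<le> (\<Sum>k. B (k + Suc d) * (1/2) ^ k) * norm w ^ Suc d"
      using sums_unique[OF tail] suminf_mult[OF summ', of "norm w ^ Suc d"]
      by (simp only: lessThan_Suc_atMost mult.commute)
  qed
qed


section \<open>Moments and homogeneous parts of the field\<close>

text \<open>
  This is the invertibility of a Vandermonde matrix: by linearity the hypothesis extends from powers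
  to all polynomials, and one can choose a polynomial that vanishes at every node except \<open>u l\<close>.
\<close>

lemma power_sums_zero_imp_zero:
  fixes c u :: "'i \<Rightarrow> 'a :: field"
  assumes "finite J" "inj_on u J" and zero: "\<And>k. (\<Sum>j\<in>J. c j * u j ^ k) = 0" and "l \<in> J"
  shows "c l = 0"
proof -
  have poly_zero: "(\<Sum>j\<in>J. c j * poly P (u j)) = 0" for P
  proof -
    have "(\<Sum>j\<in>J. c j * poly P (u j)) = (\<Sum>j\<in>J. \<Sum>k\<le>degree P. coeff P k * (c j * u j ^ k))"
      by (simp add: poly_altdef sum_distrib_left mult_ac)
    also have "\<dots> = (\<Sum>k\<le>degree P. coeff P k * (\<Sum>j\<in>J. c j * u j ^ k))"
      by (subst sum.swap) (simp add: sum_distrib_left)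
    finally show ?thesis
      using zero by simp
  qed
  define P where "P = (\<Prod>i\<in>J - {l}. [:- u i, 1:])"
  have "poly P (u j) = 0" if "j \<in> J - {l}" for j
    using that \<open>finite J\<close> by (auto simp: P_def poly_prod)
  then have "(\<Sum>j\<in>J - {l}. c j * poly P (u j)) = 0"
    by simp
  with poly_zero[of P] have "c l * poly P (u l) = 0"
    using \<open>finite J\<close> \<open>l \<in> J\<close> by (simp add: sum.remove)
  moreover have "poly P (u l) \<noteq> 0"
    using assms by (auto simp: P_def poly_prod inj_on_def)
  ultimately show ?thesis
    by simp
qed

locale axial_charges =
  fixes J :: "'i set" and x a :: "'i \<Rightarrow> real"
  assumes finite_J: "finite J" and J_nonempty: "J \<noteq> {}" and inj_x: "inj_on x J"
    and charge_nonzero: "\<And>j. j \<in> J \<Longrightarrow> a j \<noteq> 0"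
begin

definition charge_field :: "complex \<Rightarrow> complex" where
  "charge_field z = (\<Sum>j\<in>J. of_real (a j) * point_field (of_real (x j) - z))"

text \<open>
  The factor by which \<open>x j - (p + h) = (x j - p) * (1 - recip p j * h)\<close> brings the charge \<open>j\<close> to
  distance one.
\<close>

definition recip :: "complex \<Rightarrow> 'i \<Rightarrow> complex" where
  "recip p j = 1 / (of_real (x j) - p)"

definition moment :: "complex \<Rightarrow> nat \<Rightarrow> nat \<Rightarrow> complex" where
  "moment p m n = (\<Sum>j\<in>J. of_real (a j * norm (recip p j)) * recip p j ^ m * cnj (recip p j) ^ n)"

text \<open>
  The part of degree \<open>k\<close> of \<open>charge_field (p + h)\<close> in \<open>h\<close> and \<open>cnj h\<close>.
\<close>

definition taylor_form :: "complex \<Rightarrow> nat \<Rightarrow> complex \<Rightarrow> complex" where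
  "taylor_form p k h = (\<Sum>j\<in>J. of_real (a j) * point_field (of_real (x j) - p) * point_form k (recip p j * h))"

text \<open>
  A charge enters with the factor \<open>point_field (1 / u) = norm u * u\<close>, where \<open>u = recip p j\<close>. Its
  first part is in the weight of the moments, and its second part raises their first index by one.
\<close>

lemma taylor_form_eq_moments:
  "taylor_form p k h = (\<Sum>i\<le>k. of_real (binom_coeff (3/2) i * binom_coeff (1/2) (k - i))
      * moment p (Suc i) (k - i) * h ^ i * cnj h ^ (k - i))"
proof -
  have "point_field (of_real (x j) - p) = of_real (norm (recip p j)) * recip p j" for j
    by (simp add: point_field_def recip_def norm_divide)
  then have "taylor_form p k h = (\<Sum>j\<in>J. \<Sum>i\<le>k. of_real (a j * norm (recip p j)) * recip p j *
      (of_real (binom_coeff (3/2) i) * (recip p j * h) ^ i *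
       (of_real (binom_coeff (1/2) (k - i)) * cnj (recip p j * h) ^ (k - i))))"
    by (simp add: taylor_form_def point_form_def sum_distrib_left mult.assoc)
  also have "\<dots> = (\<Sum>i\<le>k. \<Sum>j\<in>J. of_real (a j * norm (recip p j)) * recip p j *
      (of_real (binom_coeff (3/2) i) * (recip p j * h) ^ i *
       (of_real (binom_coeff (1/2) (k - i)) * cnj (recip p j * h) ^ (k - i))))"
    by (rule sum.swap)
  also have "\<dots> = (\<Sum>i\<le>k. of_real (binom_coeff (3/2) i * binom_coeff (1/2) (k - i))
      * moment p (Suc i) (k - i) * h ^ i * cnj h ^ (k - i))"
    by (intro sum.cong refl)
      (simp add: moment_def sum_distrib_left sum_distrib_right power_mult_distrib mult_ac)
  finally show ?thesis .
qed

lemma taylor_form_homogeneous: "taylor_form p k (of_real t * h) = of_real t ^ k * taylor_form p k h"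
proof -
  have "point_form k (recip p j * (of_real t * h)) = of_real t ^ k * point_form k (recip p j * h)" for j
    using point_form_homogeneous[of k t "recip p j * h"] by (simp only: mult.left_commute)
  then show ?thesis
    by (simp add: taylor_form_def sum_distrib_left mult_ac)
qed

text \<open>
  Each charge contributes the remainder of \<open>point_field\<close> at \<open>w = recip p j * h\<close>, and \<open>\<delta>\<close> only has to
  bring all these \<open>w\<close> into the disk of radius \<open>1/2\<close>.
\<close>

lemma charge_field_remainder:
  assumes off: "\<And>j. j \<in> J \<Longrightarrow> p \<noteq> of_real (x j)"
  obtains C \<delta> where "C \<ge> 0" "\<delta> > 0" "\<And>h. norm h < \<delta> \<Longrightarrow>
     norm (charge_field (p + h) - (\<Sum>k\<le>d. taylor_form p k h)) \<le> C * norm h ^ Suc d"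
proof -
  obtain C0 where C0: "C0 \<ge> 0" "\<And>w. norm w \<le> 1/2 \<Longrightarrow>
     norm (point_field (1 - w) - (\<Sum>k\<le>d. point_form k w)) \<le> C0 * norm w ^ Suc d"
    using point_field_remainder[of d] by blast
  define wt where "wt j = of_real (a j) * point_field (of_real (x j) - p)" for j
  define S where "S = (\<Sum>j\<in>J. norm (recip p j))"
  have "S \<ge> 0" by (simp add: S_def sum_nonneg)
  show thesis
  proof
    show "0 < 1 / (2 * (1 + S))" using \<open>S \<ge> 0\<close> by simp
    show "0 \<le> (\<Sum>j\<in>J. norm (wt j) * (C0 * norm (recip p j) ^ Suc d))"
      using C0(1) by (intro sum_nonneg) auto
    fix h :: complex assume h: "norm h < 1 / (2 * (1 + S))"
    have small: "norm (recip p j * h) \<le> 1/2" if "j \<in> J" for j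
    proof -
      have "norm (recip p j) \<le> S"
        unfolding S_def using that finite_J by (intro member_le_sum) auto
      then have "norm (recip p j) * norm h \<le> (1 + S) * (1 / (2 * (1 + S)))"
        using h by (intro mult_mono) (auto simp: \<open>S \<ge> 0\<close>)
      also have "\<dots> = 1/2" using \<open>S \<ge> 0\<close> by (simp add: field_simps)
      finally show ?thesis by (simp add: norm_mult)
    qed
    have "charge_field (p + h) = (\<Sum>j\<in>J. wt j * point_field (1 - recip p j * h))"
      unfolding charge_field_def
    proof (intro sum.cong refl)
      fix j assume "j \<in> J"
      then have "of_real (x j) - (p + h) = (of_real (x j) - p) * (1 - recip p j * h)"
        using off[of j] by (simp add: recip_def field_simps)
      then show "of_real (a j) * point_field (of_real (x j) - (p + h)) = wt j * point_field (1 - recip p j * h)"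
        by (simp add: wt_def point_field_mult)
    qed
    moreover have "(\<Sum>k\<le>d. taylor_form p k h) = (\<Sum>j\<in>J. wt j * (\<Sum>k\<le>d. point_form k (recip p j * h)))"
      unfolding taylor_form_def wt_def sum_distrib_left by (rule sum.swap)
    ultimately have "charge_field (p + h) - (\<Sum>k\<le>d. taylor_form p k h) =
        (\<Sum>j\<in>J. wt j * (point_field (1 - recip p j * h) - (\<Sum>k\<le>d. point_form k (recip p j * h))))"
      by (simp add: sum_subtractf right_diff_distrib)
    also have "norm \<dots> \<le> (\<Sum>j\<in>J. norm (wt j) * (C0 * norm (recip p j * h) ^ Suc d))"
    proof (rule sum_norm_le)
      fix j assume "j \<in> J"
      show "norm (wt j * (point_field (1 - recip p j * h) - (\<Sum>k\<le>d. point_form k (recip p j * h))))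
          \<le> norm (wt j) * (C0 * norm (recip p j * h) ^ Suc d)"
        unfolding norm_mult[of "wt j"] by (intro mult_left_mono C0(2) small \<open>j \<in> J\<close> norm_ge_zero)
    qed
    also have "\<dots> = (\<Sum>j\<in>J. norm (wt j) * (C0 * norm (recip p j) ^ Suc d)) * norm h ^ Suc d"
      unfolding sum_distrib_right by (simp only: norm_mult power_mult_distrib mult_ac)
    finally show "norm (charge_field (p + h) - (\<Sum>k\<le>d. taylor_form p k h))
        \<le> (\<Sum>j\<in>J. norm (wt j) * (C0 * norm (recip p j) ^ Suc d)) * norm h ^ Suc d" .
  qed
qed

section \<open>Isolation of the zeros\<close>

text \<open>
  The leading form is bounded below on the unit circle by compactness, hence by a multiple of
  \<open>norm h ^ d\<close> everywhere, and this beats the remainder of order \<open>d + 1\<close>.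
\<close>

lemma charge_field_nonzero_near_of_leading_form:
  assumes off: "\<And>j. j \<in> J \<Longrightarrow> p \<noteq> of_real (x j)"
    and lower: "\<And>k h. k < d \<Longrightarrow> taylor_form p k h = 0"
    and leading: "\<And>h. h \<noteq> 0 \<Longrightarrow> taylor_form p d h \<noteq> 0"
  shows "eventually (\<lambda>z. charge_field z \<noteq> 0) (at p)"
proof -
  obtain C \<delta> where C: "C \<ge> 0" "\<delta> > 0" "\<And>h. norm h < \<delta> \<Longrightarrow>
     norm (charge_field (p + h) - (\<Sum>k\<le>d. taylor_form p k h)) \<le> C * norm h ^ Suc d"
    using charge_field_remainder[OF off, of d] by blast
  have "continuous_on (sphere 0 1) (\<lambda>h. norm (taylor_form p d h))"
    unfolding taylor_form_def point_form_def by (intro continuous_intros)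
  then obtain v where v: "v \<in> sphere 0 1" "\<And>h. h \<in> sphere 0 1 \<Longrightarrow> norm (taylor_form p d v) \<le> norm (taylor_form p d h)"
    using continuous_attains_inf[of "sphere (0::complex) 1"] by fastforce
  define \<kappa> where "\<kappa> = norm (taylor_form p d v)"
  have "\<kappa> > 0" using v(1) leading[of v] by (force simp: \<kappa>_def)
  have lower_bound: "\<kappa> * norm h ^ d \<le> norm (taylor_form p d h)" if "h \<noteq> 0" for h
  proof -
    have "h = of_real (norm h) * (h / of_real (norm h))" using that by simp
    then have "taylor_form p d h = of_real (norm h) ^ d * taylor_form p d (h / of_real (norm h))"
      by (metis taylor_form_homogeneous)
    then have eq: "norm (taylor_form p d h) = norm (taylor_form p d (h / of_real (norm h))) * norm h ^ d"
      by (simp add: norm_mult norm_power)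
    have "\<kappa> \<le> norm (taylor_form p d (h / of_real (norm h)))"
      unfolding \<kappa>_def using that by (intro v(2)) (simp add: norm_divide)
    then show ?thesis
      unfolding eq by (rule mult_right_mono) simp
  qed
  have "charge_field z \<noteq> 0" if z: "z \<noteq> p" "dist z p < min \<delta> (\<kappa> / (C + 1))" for z
  proof
    assume zero: "charge_field z = 0"
    define h where "h = z - p"
    have h: "h \<noteq> 0" "norm h < \<delta>" "norm h < \<kappa> / (C + 1)" "z = p + h"
      using z by (auto simp: h_def dist_norm)
    have "(\<Sum>k\<le>d. taylor_form p k h) = taylor_form p d h"
      using lower by (simp flip: lessThan_Suc_atMost)
    with C(3)[OF h(2)] have "norm (taylor_form p d h) \<le> C * norm h ^ Suc d"
      using zero h(4) by simp
    with lower_bound[OF h(1)] have "\<kappa> * norm h ^ d \<le> (C * norm h) * norm h ^ d"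
      by (simp add: mult_ac)
    then have "\<kappa> \<le> C * norm h"
      using h(1) by (subst (asm) mult_le_cancel_right_pos) auto
    also have "\<dots> \<le> (C + 1) * norm h" by (simp add: distrib_right)
    also have "\<dots> < \<kappa>" using h(3) C(1) by (simp add: field_simps)
    finally show False by simp
  qed
  moreover have "min \<delta> (\<kappa> / (C + 1)) > 0" using C \<open>\<kappa> > 0\<close> by simp
  ultimately show ?thesis
    unfolding eventually_at by blast
qed

text \<open>
  If all these moments were zero, the distinct numbers \<open>recip p j\<close> with the nonzero weights
  \<open>a j * norm (recip p j) * recip p j\<close> would contradict \<open>power_sums_zero_imp_zero\<close>.
\<close>

lemma exists_nonzero_moment:
  assumes off: "\<And>j. j \<in> J \<Longrightarrow> p \<noteq> of_real (x j)"
  shows "\<exists>k. moment p (Suc k) 0 \<noteq> 0"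
proof (rule ccontr)
  assume "\<nexists>k. moment p (Suc k) 0 \<noteq> 0"
  then have zero: "(\<Sum>j\<in>J. (of_real (a j * norm (recip p j)) * recip p j) * recip p j ^ k) = 0" for k
    by (simp add: moment_def mult.assoc)
  have recip_nz: "recip p j \<noteq> 0" if "j \<in> J" for j
    using off[OF that] by (simp add: recip_def)
  have "inj_on (recip p) J"
    using inj_x off by (auto simp: inj_on_def recip_def)
  moreover obtain l where "l \<in> J" using J_nonempty by blast
  ultimately have "of_real (a l * norm (recip p l)) * recip p l = 0"
    using power_sums_zero_imp_zero[OF finite_J _ zero] by blast
  then show False
    using recip_nz[OF \<open>l \<in> J\<close>] charge_nonzero[OF \<open>l \<in> J\<close>] by simp
qed

text \<open>
  As \<open>x j\<close> is real, the reciprocals of \<open>recip p j\<close> and of its conjugate differ by \<open>cnj p - p\<close>,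
  whatever \<open>j\<close> is. Off the axis the relation therefore expresses a mixed moment by two moments whose
  total degree is lower by one.
\<close>

lemma moment_relation:
  assumes off: "\<And>j. j \<in> J \<Longrightarrow> p \<noteq> of_real (x j)"
  shows "(cnj p - p) * moment p (Suc m) (Suc n) = moment p m (Suc n) - moment p (Suc m) n"
proof -
  have "(cnj p - p) * (recip p j ^ Suc m * cnj (recip p j) ^ Suc n) =
      recip p j ^ m * cnj (recip p j) ^ Suc n - recip p j ^ Suc m * cnj (recip p j) ^ n" if "j \<in> J" for j
  proof -
    have nz: "of_real (x j) - p \<noteq> 0" using off[OF that] by simp
    then have nz': "of_real (x j) - cnj p \<noteq> 0"
      by (metis complex_cnj_cnj complex_cnj_complex_of_real complex_cnj_diff complex_cnj_zero)
    have "(cnj p - p) * (recip p j * cnj (recip p j)) = cnj (recip p j) - recip p j"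
      using nz nz' by (simp add: recip_def field_simps)
    then have "recip p j ^ m * cnj (recip p j) ^ n * ((cnj p - p) * (recip p j * cnj (recip p j)))
        = recip p j ^ m * cnj (recip p j) ^ n * (cnj (recip p j) - recip p j)"
      by (simp only:)
    then show ?thesis by (simp add: algebra_simps)
  qed
  then have "of_real (a j * norm (recip p j)) * ((cnj p - p) * (recip p j ^ Suc m * cnj (recip p j) ^ Suc n)) =
      of_real (a j * norm (recip p j)) * (recip p j ^ m * cnj (recip p j) ^ Suc n - recip p j ^ Suc m * cnj (recip p j) ^ n)"
    if "j \<in> J" for j
    using that by (simp only:)
  then have "(\<Sum>j\<in>J. of_real (a j * norm (recip p j)) * ((cnj p - p) * (recip p j ^ Suc m * cnj (recip p j) ^ Suc n))) =
      (\<Sum>j\<in>J. of_real (a j * norm (recip p j)) * (recip p j ^ m * cnj (recip p j) ^ Suc n - recip p j ^ Suc m * cnj (recip p j) ^ n))"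
    by (intro sum.cong refl)
  then show ?thesis
    unfolding moment_def sum_distrib_left sum_subtractf[symmetric]
    by (simp only: mult_ac right_diff_distrib)
qed

lemma cnj_moment: "cnj (moment p m n) = moment p n m"
  by (simp add: moment_def mult_ac)

text \<open>
  By \<open>moment_relation\<close> the vanishing spreads from the pure moments (and their conjugates) to the mixed
  ones, by induction on the total degree.
\<close>

lemma moments_vanish:
  assumes off: "\<And>j. j \<in> J \<Longrightarrow> p \<noteq> of_real (x j)" and "Im p \<noteq> 0"
    and zero: "\<And>k. k < d \<Longrightarrow> moment p (Suc k) 0 = 0"
  shows "1 \<le> m + n \<Longrightarrow> m + n \<le> d \<Longrightarrow> moment p m n = 0"
proof (induction "m + n" arbitrary: m n rule: less_induct)
  case less
  consider m' where "m = Suc m'" "n = 0" | n' where "m = 0" "n = Suc n'"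
    | m' n' where "m = Suc m'" "n = Suc n'"
    using less.prems by (cases m; cases n) auto
  then show ?case
  proof cases
    case 1
    then show ?thesis using zero less.prems by simp
  next
    case 2
    then show ?thesis using zero[of n'] cnj_moment[of p n 0] less.prems by simp
  next
    case 3
    have "moment p m' (Suc n') = 0" "moment p (Suc m') n' = 0"
      using less.prems 3 by (auto intro!: less.hyps)
    then have "(cnj p - p) * moment p m n = 0"
      using moment_relation[OF off, of m' n'] 3 by simp
    moreover have "cnj p \<noteq> p"
      using \<open>Im p \<noteq> 0\<close> by (simp add: complex_eq_iff)
    ultimately show ?thesis by simp
  qed
qed

text \<open>
  The first nonzero pure moment determines the degree of the leading form. On the axis this form is
  a multiple of \<open>point_form d h\<close>, off the axis a multiple of \<open>h ^ d\<close>.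
\<close>

lemma charge_field_nonzero_near_non_charge:
  assumes off: "\<And>j. j \<in> J \<Longrightarrow> p \<noteq> of_real (x j)"
  shows "eventually (\<lambda>z. charge_field z \<noteq> 0) (at p)"
proof -
  define d where "d = (LEAST k. moment p (Suc k) 0 \<noteq> 0)"
  have nz: "moment p (Suc d) 0 \<noteq> 0"
    unfolding d_def using exists_nonzero_moment[OF off] by (rule LeastI_ex)
  have zero: "moment p (Suc k) 0 = 0" if "k < d" for k
    using not_less_Least[OF that[unfolded d_def]] by simp
  have "(\<forall>k<d. \<forall>h. taylor_form p k h = 0) \<and> (\<forall>h. h \<noteq> 0 \<longrightarrow> taylor_form p d h \<noteq> 0)"
  proof (cases "Im p = 0")
    case True
    then have "cnj p = p"
      by (simp add: complex_eq_iff)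
    then have "cnj (recip p j) = recip p j" for j
      by (simp add: recip_def)
    then have "moment p m n = moment p (m + n) 0" for m n
      by (simp add: moment_def power_add mult.assoc)
    then have "moment p (Suc i) (k - i) = moment p (Suc k) 0" if "i \<le> k" for i k
      using that by (metis add_0_right add_Suc le_add_diff_inverse)
    then have "taylor_form p k h = moment p (Suc k) 0 * point_form k h" for k h
      unfolding taylor_form_eq_moments point_form_def sum_distrib_left
      by (intro sum.cong) (auto simp: mult_ac)
    then show ?thesis
      using nz zero point_form_nonzero by simp
  next
    case False
    note vanish = moments_vanish[OF off False zero]
    have lower: "taylor_form p k h = 0" if "k < d" for k h
      unfolding taylor_form_eq_moments using that by (intro sum.neutral) (auto simp: vanish)
    have "taylor_form p d h = of_real (binom_coeff (3/2) d) * moment p (Suc d) 0 * h ^ d" for h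
    proof -
      \<comment> \<open>These moments have total degree \<open>d + 1\<close>, one more than \<open>vanish\<close> covers; the relation
        expresses them by moments of total degree \<open>d\<close>.\<close>
      have mixed: "moment p (Suc i) (d - i) = 0" if i: "i < d" for i
      proof -
        obtain n where n: "d - i = Suc n" using i by (metis Suc_diff_Suc)
        have "moment p i (Suc n) = 0" "moment p (Suc i) n = 0"
          using n i by (auto intro!: vanish)
        then have "(cnj p - p) * moment p (Suc i) (Suc n) = 0"
          using moment_relation[OF off, of i n] by simp
        moreover have "cnj p \<noteq> p"
          using False by (simp add: complex_eq_iff)
        ultimately show ?thesis using n by simp
      qed
      then show ?thesis
        unfolding taylor_form_eq_moments by (simp flip: lessThan_Suc_atMost)
    qed
    then have "taylor_form p d h \<noteq> 0" if "h \<noteq> 0" for h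
      using that nz binom_coeff_pos[of "3/2" d] by simp
    with lower show ?thesis by blast
  qed
  then show ?thesis
    by (intro charge_field_nonzero_near_of_leading_form[OF off, of d]) auto
qed

text \<open>
  Multiplied by \<open>(x l - z) * norm (x l - z)\<close>, the field tends to \<open>a l\<close>.
\<close>

lemma charge_field_nonzero_near_charge:
  assumes "l \<in> J"
  shows "eventually (\<lambda>z. charge_field z \<noteq> 0) (at (of_real (x l)))"
proof -
  define D where "D z = (of_real (x l) - z) * of_real (norm (of_real (x l) - z))" for z :: complex
  define rest where "rest z = (\<Sum>j\<in>J - {l}. of_real (a j) * point_field (of_real (x j) - z))" for z :: complex
  have "((\<lambda>z. of_real (a l) + D z * rest z) \<longlongrightarrow> of_real (a l) + D (of_real (x l)) * rest (of_real (x l)))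
      (at (of_real (x l)))"
    unfolding D_def rest_def point_field_def
    using assms inj_x by (intro tendsto_intros) (auto simp: inj_on_def)
  then have "((\<lambda>z. of_real (a l) + D z * rest z) \<longlongrightarrow> of_real (a l)) (at (of_real (x l)))"
    by (simp add: D_def)
  then have "eventually (\<lambda>z. of_real (a l) + D z * rest z \<noteq> 0) (at (of_real (x l)))"
    by (rule tendsto_imp_eventually_ne) (use assms charge_nonzero in simp)
  moreover have "eventually (\<lambda>z. z \<noteq> of_real (x l)) (at (of_real (x l) :: complex))"
    by (simp add: eventually_at_filter)
  ultimately show ?thesis
  proof eventually_elim
    case (elim z)
    have "charge_field z = of_real (a l) * point_field (of_real (x l) - z) + rest z"
      unfolding charge_field_def rest_def using finite_J assms by (simp add: sum.remove)
    then have "D z * charge_field z = of_real (a l) + D z * rest z"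
      using elim(2) by (simp add: D_def point_field_def distrib_left)
    with elim(1) show ?case by auto
  qed
qed

lemma zeros_of_charge_field_isolated: "\<not> p islimpt {z. charge_field z = 0}"
proof -
  have "eventually (\<lambda>z. charge_field z \<noteq> 0) (at p)"
    using charge_field_nonzero_near_non_charge[of p] charge_field_nonzero_near_charge by blast
  then show ?thesis
    by (simp add: islimpt_iff_eventually)
qed

end

section \<open>Finiteness in disks\<close>

lemma charge_field_conv_components:
  assumes "(u, v) \<notin> charge_points M xs" and J: "J = {j \<in> {1..M}. a j \<noteq> 0}"
    and ax: "axial_charges J xs a"
  shows "axial_charges.charge_field J xs a (Complex u v) = Complex (- field_X M xs a u v) (field_Y M xs a u v)"
proof -
  interpret axial_charges J xs a by fact
  have summand: "of_real (a j) * point_field (of_real (xs j) - Complex u v) =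
      Complex (- (a j * (u - xs j) / ((u - xs j)\<^sup>2 + v\<^sup>2) powr (3/2)))
        (a j * v / ((u - xs j)\<^sup>2 + v\<^sup>2) powr (3/2))" if "j \<in> {1..M}" for j
  proof -
    define z where "z = of_real (xs j) - Complex u v"
    define r where "r = norm z"
    have z: "Re z = xs j - u" "Im z = - v"
      by (simp_all add: z_def)
    have "z \<noteq> 0"
      using assms(1) that z by (auto simp: charge_points_def complex_eq_iff)
    then have "r > 0" by (simp add: r_def)
    have r2: "(u - xs j)\<^sup>2 + v\<^sup>2 = r\<^sup>2"
      by (simp add: r_def cmod_power2 z power2_commute)
    have "(r\<^sup>2) powr (3/2) = (r powr 2) powr (3/2)"
      using \<open>r > 0\<close> by simp
    also have "\<dots> = r powr 3"
      by (simp only: powr_powr) simp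
    also have "\<dots> = r ^ 3"
      using \<open>r > 0\<close> by simp
    finally have r3: "((u - xs j)\<^sup>2 + v\<^sup>2) powr (3/2) = r ^ 3"
      by (simp only: r2)
    have "z * cnj z = of_real (r\<^sup>2)"
      by (simp only: complex_norm_square r_def)
    then have "point_field z = cnj z / of_real (r ^ 3)"
      using \<open>z \<noteq> 0\<close> \<open>r > 0\<close>
      by (simp add: point_field_def flip: r_def) (simp add: field_simps power2_eq_square power3_eq_cube)
    then have pf: "point_field z = Complex ((xs j - u) / r ^ 3) (v / r ^ 3)"
      by (simp add: complex_eq_iff z Re_divide_of_real Im_divide_of_real del: of_real_power)
    show ?thesis
      unfolding r3 z_def[symmetric] pf
      by (simp add: complex_eq_iff right_diff_distrib diff_divide_distrib)
  qed
  have "charge_field (Complex u v) =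
      (\<Sum>j\<in>{1..M}. of_real (a j) * point_field (of_real (xs j) - Complex u v))"
    unfolding charge_field_def by (intro sum.mono_neutral_left) (auto simp: J)
  also have "\<dots> = (\<Sum>j\<in>{1..M}. Complex (- (a j * (u - xs j) / ((u - xs j)\<^sup>2 + v\<^sup>2) powr (3/2)))
        (a j * v / ((u - xs j)\<^sup>2 + v\<^sup>2) powr (3/2)))"
    by (intro sum.cong refl summand)
  also have "\<dots> = Complex (- field_X M xs a u v) (field_Y M xs a u v)"
    by (simp add: complex_eq_iff field_X_def field_Y_def sum_negf)
  finally show ?thesis .
qed

theorem proposition2p2:
  fixes M :: nat and xs a :: "nat \<Rightarrow> real" and c :: "real \<times> real" and r :: real
  assumes "M \<ge> 1"
    and "0 < xs 1"
    and "strict_mono_on {1..M} xs"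
    and "\<exists>j\<in>{1..M}. a j \<noteq> 0"
  shows "finite (field_zeros M xs a \<inter> cball c r)"
proof -
  define J where "J = {j \<in> {1..M}. a j \<noteq> 0}"
  have ax: "axial_charges J xs a"
  proof
    show "inj_on xs J"
      using strict_mono_on_imp_inj_on[OF assms(3)] by (rule inj_on_subset) (auto simp: J_def)
  qed (use assms(4) in \<open>auto simp: J_def\<close>)
  then interpret axial_charges J xs a .
  define f where "f = (\<lambda>(u, v). Complex u v)"
  have "continuous_on (cball c r) f"
    unfolding f_def case_prod_beta Complex_eq by (intro continuous_intros)
  then have "compact (f ` cball c r)"
    by (intro compact_continuous_image compact_cball)
  then have "finite (f ` cball c r \<inter> {z. charge_field z = 0})"
    by (intro finite_not_islimpt_in_compact zeros_of_charge_field_isolated)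
  moreover have "f ` (field_zeros M xs a \<inter> cball c r) \<subseteq> f ` cball c r \<inter> {z. charge_field z = 0}"
    using charge_field_conv_components[OF _ J_def ax]
    by (auto simp: f_def field_zeros_def complex_eq_iff)
  ultimately have "finite (f ` (field_zeros M xs a \<inter> cball c r))"
    by (rule finite_subset[rotated])
  moreover have "inj_on f (field_zeros M xs a \<inter> cball c r)"
    by (auto simp: f_def inj_on_def)
  ultimately show ?thesis
    by (rule finite_imageD)
qed

end
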